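(* Let $\mathbb{D}$ be a small category, $\mathsf{K}$ a small $\mathsf{DCpo}^\vee$-enriched category that is additionally left distributive, $J$ a subcategory containing all objects of $\mathsf{K}$, and assume $\mathsf{K}$ admits coproducts of all families indexed by objects of $\mathbb{D}$ with cotupling preserving the order. Let $\pi\in[\mathbb{D},\mathsf{K}]^J$, $X=\sum_{D\in\mathbb{D}}\pi(D)$ and $f:X\to Y$ an arrow of $J$. Then $$\mu x.\Big(f\vee\bigvee_{d:D_1\to D_2\in\mathbb{D}}x\circ\overline{\pi(d)}\Big)=f\circ\mu x.\Big(id_X\vee\bigvee_{d:D_1\to D_2\in\mathbb{D}}x\circ\overline{\pi(d)}\Big);$$ consequently, for any $\beta:Y\to Y$ in $\mathsf{K}$, $\mu x.(f\vee\bigvee_d x\circ\overline{\pi(d)})=\beta\circ f$ holds if and only if $f\circ\mu x.(id_X\vee\bigvee_d x\circ\overline{\pi(d)})=\beta\circ f$.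
   Context: Lax functors $\pi:\mathbb{D}\to\mathsf{K}$ satisfy $id_{\pi D}\leq\pi(id_D)$ and $\pi(d_1)\circ\pi(d_2)\leq\pi(d_1\circ d_2)$; $[\mathbb{D},\mathsf{K}]^J$ has lax functors as objects and oplax transformations with components in $J$ as morphisms. $\mathsf{DCpo}^\vee$-enriched: hom-sets have directed suprema and binary joins, composition monotone and preserving directed suprema in each variable. Left distributive: $h\circ(f\vee g)=h\circ f\vee h\circ g$. Cotupling preserves order: $f_i\leq g_i$ for all $i$ implies $[f_i]\leq[g_i]$. For $d:D_1\to D_2$, $\overline{\pi(d)}:X\to X$ is the cotuple $[\delta_D]_D$ with $\delta_{D_1}=\mathsf{in}_{\pi D_2}\circ\pi(d)$ and $\delta_D=\mathsf{in}_{\pi D}$ for $D\neq D_1$. $\bigvee_d x\circ\overline{\pi(d)}$ is the supremum of the directed set of finite joins of the $x\circ\overline{\pi(d)}$; $\mu x.F(x)$ denotes the least fixed point of the map $F$ on the relevant hom-poset. *)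

theory Defs
  imports "HOL-Algebra.Complete_Lattice"
begin

section \<open>Categories and subcategories\<close>

text \<open>All categories below are small: objects and arrows form sets. Composition is written in
  functional order, so \<open>g \<odot> f\<close> is \<open>f\<close> followed by \<open>g\<close>; it is only constrained on composable arrows.\<close>

record ('o, 'm) category =
  Obj :: "'o set"
  Arr :: "'m set"
  Dom :: "'m \<Rightarrow> 'o"
  Cod :: "'m \<Rightarrow> 'o"
  Id  :: "'o \<Rightarrow> 'm"
  Comp :: "'m \<Rightarrow> 'm \<Rightarrow> 'm" (infixl \<open>\<odot>\<index>\<close> 75)

definition Hom :: "('o, 'm, 'z) category_scheme \<Rightarrow> 'o \<Rightarrow> 'o \<Rightarrow> 'm set" where
  "Hom C A B = {f \<in> Arr C. Dom C f = A \<and> Cod C f = B}"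

locale category =
  fixes C (structure)
  assumes Dom_in_Obj: "f \<in> Arr C \<Longrightarrow> Dom C f \<in> Obj C"
    and Cod_in_Obj: "f \<in> Arr C \<Longrightarrow> Cod C f \<in> Obj C"
    and Id_in_Hom: "A \<in> Obj C \<Longrightarrow> Id C A \<in> Hom C A A"
    and Comp_in_Hom: "\<lbrakk>f \<in> Hom C A B; g \<in> Hom C B E\<rbrakk> \<Longrightarrow> g \<odot> f \<in> Hom C A E"
    and Id_left: "f \<in> Hom C A B \<Longrightarrow> Id C B \<odot> f = f"
    and Id_right: "f \<in> Hom C A B \<Longrightarrow> f \<odot> Id C A = f"
    and Comp_assoc: "\<lbrakk>f \<in> Hom C A B; g \<in> Hom C B E; h \<in> Hom C E F\<rbrakk> \<Longrightarrow>
      h \<odot> (g \<odot> f) = (h \<odot> g) \<odot> f"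

definition subcategory ::
  "('o, 'm, 'y) category_scheme \<Rightarrow> ('o, 'm, 'z) category_scheme \<Rightarrow> bool" where
  "subcategory J K \<longleftrightarrow> category J \<and> category K \<and> Obj J \<subseteq> Obj K \<and> Arr J \<subseteq> Arr K \<and>
    (\<forall>f \<in> Arr J. Dom J f = Dom K f \<and> Cod J f = Cod K f) \<and>
    (\<forall>A \<in> Obj J. Id J A = Id K A) \<and>
    (\<forall>f \<in> Arr J. \<forall>g \<in> Arr J. Cod J f = Dom J g \<longrightarrow> g \<odot>\<^bsub>J\<^esub> f = g \<odot>\<^bsub>K\<^esub> f)"


section \<open>Order enrichment\<close>

record ('o, 'm) ord_category = "('o, 'm) category" +
  Le :: "'m \<Rightarrow> 'm \<Rightarrow> bool"

definition hom_poset :: "('o, 'm, 'z) ord_category_scheme \<Rightarrow> 'o \<Rightarrow> 'o \<Rightarrow> 'm gorder" where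
  "hom_poset K A B = \<lparr>carrier = Hom K A B, eq = (=), le = Le K\<rparr>"

text \<open>Directed sets are nonempty, so a dcpo need not have a bottom element.\<close>

definition directed :: "('a, 'b) gorder_scheme \<Rightarrow> 'a set \<Rightarrow> bool" where
  "directed L S \<longleftrightarrow> S \<subseteq> carrier L \<and> S \<noteq> {} \<and>
    (\<forall>x \<in> S. \<forall>y \<in> S. \<exists>z \<in> S. x \<sqsubseteq>\<^bsub>L\<^esub> z \<and> y \<sqsubseteq>\<^bsub>L\<^esub> z)"

locale dcpo_with_joins = upper_semilattice +
  assumes directed_sup_exists: "directed L S \<Longrightarrow> \<exists>s. least L s (Upper L S)"

locale dcpo_join_category = category K for K (structure) +
  assumes hom_dcpo: "\<lbrakk>A \<in> Obj K; B \<in> Obj K\<rbrakk> \<Longrightarrow> dcpo_with_joins (hom_poset K A B)"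
    and Comp_mono: "\<lbrakk>f \<in> Hom K A B; f' \<in> Hom K A B; g \<in> Hom K B E; g' \<in> Hom K B E;
        Le K f f'; Le K g g'\<rbrakk> \<Longrightarrow> Le K (g \<odot> f) (g' \<odot> f')"
    and Comp_sup_left: "\<lbrakk>f \<in> Hom K A B; E \<in> Obj K; directed (hom_poset K B E) S\<rbrakk> \<Longrightarrow>
        (\<Squnion>\<^bsub>hom_poset K B E\<^esub> S) \<odot> f = \<Squnion>\<^bsub>hom_poset K A E\<^esub> ((\<lambda>g. g \<odot> f) ` S)"
    and Comp_sup_right: "\<lbrakk>A \<in> Obj K; g \<in> Hom K B E; directed (hom_poset K A B) S\<rbrakk> \<Longrightarrow>
        g \<odot> (\<Squnion>\<^bsub>hom_poset K A B\<^esub> S) = \<Squnion>\<^bsub>hom_poset K A E\<^esub> ((\<lambda>f. g \<odot> f) ` S)"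

definition left_distributive :: "('o, 'm, 'z) ord_category_scheme \<Rightarrow> bool" where
  "left_distributive K \<longleftrightarrow>
    (\<forall>A \<in> Obj K. \<forall>B \<in> Obj K. \<forall>E \<in> Obj K. \<forall>f \<in> Hom K A B. \<forall>g \<in> Hom K A B. \<forall>h \<in> Hom K B E.
      h \<odot>\<^bsub>K\<^esub> (f \<squnion>\<^bsub>hom_poset K A B\<^esub> g)
        = (h \<odot>\<^bsub>K\<^esub> f) \<squnion>\<^bsub>hom_poset K A E\<^esub> (h \<odot>\<^bsub>K\<^esub> g))"


section \<open>Coproducts\<close>

definition is_coproduct ::
  "('o, 'm, 'z) category_scheme \<Rightarrow> 'i set \<Rightarrow> ('i \<Rightarrow> 'o) \<Rightarrow> 'o \<Rightarrow> ('i \<Rightarrow> 'm) \<Rightarrow> bool" where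
  "is_coproduct K I P X \<iota> \<longleftrightarrow> X \<in> Obj K \<and> (\<forall>i \<in> I. P i \<in> Obj K \<and> \<iota> i \<in> Hom K (P i) X) \<and>
    (\<forall>Z \<in> Obj K. \<forall>g. (\<forall>i \<in> I. g i \<in> Hom K (P i) Z) \<longrightarrow>
      (\<exists>!h. h \<in> Hom K X Z \<and> (\<forall>i \<in> I. h \<odot>\<^bsub>K\<^esub> \<iota> i = g i)))"

definition cotuple ::
  "('o, 'm, 'z) category_scheme \<Rightarrow> 'i set \<Rightarrow> 'o \<Rightarrow> ('i \<Rightarrow> 'm) \<Rightarrow> 'o \<Rightarrow> ('i \<Rightarrow> 'm) \<Rightarrow> 'm" where
  "cotuple K I X \<iota> Z g = (THE h. h \<in> Hom K X Z \<and> (\<forall>i \<in> I. h \<odot>\<^bsub>K\<^esub> \<iota> i = g i))"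

definition admits_coproducts :: "('o, 'm, 'z) category_scheme \<Rightarrow> 'i set \<Rightarrow> bool" where
  "admits_coproducts K I \<longleftrightarrow>
    (\<forall>P. (\<forall>i \<in> I. P i \<in> Obj K) \<longrightarrow> (\<exists>X \<iota>. is_coproduct K I P X \<iota>))"

text \<open>The condition does not depend on the choice of the coproducts, because
  composition is monotone and coproducts are unique up to isomorphism.\<close>

definition cotupling_monotone :: "('o, 'm, 'z) ord_category_scheme \<Rightarrow> 'i set \<Rightarrow> bool" where
  "cotupling_monotone K I \<longleftrightarrow>
    (\<forall>P X \<iota>. is_coproduct K I P X \<iota> \<longrightarrow>
      (\<forall>Z \<in> Obj K. \<forall>f g. (\<forall>i \<in> I. f i \<in> Hom K (P i) Z \<and> g i \<in> Hom K (P i) Z \<and> Le K (f i) (g i)) \<longrightarrow>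
        Le K (cotuple K I X \<iota> Z f) (cotuple K I X \<iota> Z g)))"


section \<open>Lax functors\<close>

record ('d, 'a, 'o, 'm) functor_data =
  fobj :: "'d \<Rightarrow> 'o"
  farr :: "'a \<Rightarrow> 'm"

text \<open>The lax functors are the objects of the category of lax functors and oplax transformations
  with components in \<open>J\<close>; which lax functors are objects of it does not depend on \<open>J\<close>.\<close>

definition lax_functor ::
  "('d, 'a, 'y) category_scheme \<Rightarrow> ('o, 'm, 'z) ord_category_scheme \<Rightarrow>
    ('d, 'a, 'o, 'm) functor_data \<Rightarrow> bool" where
  "lax_functor D K \<pi> \<longleftrightarrow>
    (\<forall>A \<in> Obj D. fobj \<pi> A \<in> Obj K) \<and>
    (\<forall>d \<in> Arr D. farr \<pi> d \<in> Hom K (fobj \<pi> (Dom D d)) (fobj \<pi> (Cod D d))) \<and>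
    (\<forall>A \<in> Obj D. Le K (Id K (fobj \<pi> A)) (farr \<pi> (Id D A))) \<and>
    (\<forall>d1 \<in> Arr D. \<forall>d2 \<in> Arr D. Cod D d2 = Dom D d1 \<longrightarrow>
      Le K (farr \<pi> d1 \<odot>\<^bsub>K\<^esub> farr \<pi> d2) (farr \<pi> (d1 \<odot>\<^bsub>D\<^esub> d2)))"

text \<open>The endomorphism of \<open>X\<close> that acts as \<open>\<pi> d\<close> on the summand at the domain of \<open>d\<close> and as the
  identity on the other summands.\<close>

definition lift_arr ::
  "('d, 'a, 'y) category_scheme \<Rightarrow> ('o, 'm, 'z) ord_category_scheme \<Rightarrow>
    ('d, 'a, 'o, 'm) functor_data \<Rightarrow> 'o \<Rightarrow> ('d \<Rightarrow> 'm) \<Rightarrow> 'a \<Rightarrow> 'm" where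
  "lift_arr D K \<pi> X \<iota> d = cotuple K (Obj D) X \<iota> X
     (\<lambda>A. if A = Dom D d then \<iota> (Cod D d) \<odot>\<^bsub>K\<^esub> farr \<pi> d else \<iota> A)"


section \<open>Infinite joins and least fixed points\<close>

text \<open>The join of a family as the directed supremum of its nonempty finite joins. For \<open>I = {}\<close> the
  supremum is over the empty set. In the application below this only happens if the indexing
  category is empty; then \<open>X\<close> is initial and the hom-poset is a singleton.\<close>

definition dir_join :: "('m, 'b) gorder_scheme \<Rightarrow> 'i set \<Rightarrow> ('i \<Rightarrow> 'm) \<Rightarrow> 'm" where
  "dir_join L I g = \<Squnion>\<^bsub>L\<^esub> {\<Squnion>\<^bsub>L\<^esub> (g ` S) | S. finite S \<and> S \<noteq> {} \<and> S \<subseteq> I}"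

text \<open>The library's \<open>LFP\<close> is the infimum of all prefixed points and is meant for complete
  lattices; here \<open>mu L F\<close> is literally the least element of the set of fixed points. It exists for
  \<open>sat_map\<close> below: this map \<open>F\<close> preserves directed suprema and \<open>f \<sqsubseteq> F f\<close>, so the supremum of the
  iterates \<open>F\<^sup>n f\<close> is the least fixed point, although the hom-poset need not have a bottom.\<close>

definition mu :: "('m, 'b) gorder_scheme \<Rightarrow> ('m \<Rightarrow> 'm) \<Rightarrow> 'm" where
  "mu L F = (THE m. least L m (fps L F))"

text \<open>The map sending \<open>x\<close> to the join of \<open>f\<close> and of all \<open>x \<odot> lift_arr \<dots> d\<close>, on the hom-poset
  from \<open>X\<close> to \<open>Y\<close>.\<close>

definition sat_map ::
  "('d, 'a, 'y) category_scheme \<Rightarrow> ('o, 'm, 'z) ord_category_scheme \<Rightarrow>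
    ('d, 'a, 'o, 'm) functor_data \<Rightarrow> 'o \<Rightarrow> ('d \<Rightarrow> 'm) \<Rightarrow> 'o \<Rightarrow> 'm \<Rightarrow> 'm \<Rightarrow> 'm" where
  "sat_map D K \<pi> X \<iota> Y f x =
     f \<squnion>\<^bsub>hom_poset K X Y\<^esub> dir_join (hom_poset K X Y) (Arr D) (\<lambda>d. x \<odot>\<^bsub>K\<^esub> lift_arr D K \<pi> X \<iota> d)"

end

theory Submission
  imports Defs
begin

text \<open>Both fixed points are suprema of Kleene chains: \<open>\<mu>\<close> of the map with constant term \<open>f\<close> is the
  supremum of its iterates started at \<open>f\<close> itself, because every fixed point lies above \<open>f\<close>.
  Postcomposition with \<open>f\<close> preserves binary joins by left distributivity and directed suprema by
  enrichment, hence all the joins involved, so it carries the chain for \<open>id\<close> termwise to the chain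
  for \<open>f\<close>, and the supremum to the supremum.\<close>

section \<open>Least fixed points in dcpos with binary joins\<close>

text \<open>\<open>sup\<close> is a Hilbert choice; antisymmetry leaves it a single candidate, so a
  supremum can be computed by exhibiting any least upper bound.\<close>

lemma (in partial_order) sup_eqI: "is_lub L s S \<Longrightarrow> \<Squnion>S = s"
  unfolding sup_def by (rule some_equality) (auto intro: least_unique)

text \<open>Splits off one binary join, so that induction over finite sets can apply laws stated
  only for \<open>\<squnion>\<close>.\<close>

lemma (in upper_semilattice) sup_insert:
  assumes "finite S" "S \<noteq> {}" "S \<subseteq> carrier L" "x \<in> carrier L"
  shows "\<Squnion>(insert x S) = x \<squnion> \<Squnion>S"
proof (rule sup_eqI, rule least_UpperI)
  have least: "is_lub L (\<Squnion>S) S"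
    using assms finite_sup_least by blast
  have closed: "\<Squnion>S \<in> carrier L"
    using least by simp
  show "insert x S \<subseteq> carrier L" "x \<squnion> \<Squnion>S \<in> carrier L"
    using assms closed by auto
  fix y
  show "y \<sqsubseteq> x \<squnion> \<Squnion>S" if "y \<in> insert x S"
  proof (cases "y = x")
    case True
    then show ?thesis
      using join_left[OF assms(4) closed] by simp
  next
    case False
    then have y: "y \<in> S" "y \<in> carrier L"
      using that assms(3) by auto
    have "y \<sqsubseteq> \<Squnion>S"
      using least y(1) assms(3) by (rule least_Upper_above)
    then show ?thesis
      using join_right[OF assms(4) closed] y(2) closed join_closed[OF assms(4) closed] by (rule le_trans)
  qed
  assume y: "y \<in> Upper L (insert x S)"
  then have "y \<in> Upper L S" "x \<sqsubseteq> y" "y \<in> carrier L"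
    using assms unfolding Upper_def by auto
  then show "x \<squnion> \<Squnion>S \<sqsubseteq> y"
    using join_le[OF _ _ assms(4) closed] least_le[OF least] by simp
qed

section \<open>Joins of families as directed suprema of finite joins\<close>

context dcpo_with_joins
begin

lemma directed_sup_least: "directed L S \<Longrightarrow> is_lub L (\<Squnion>S) S"
  using directed_sup_exists sup_eqI by metis

text \<open>The union of two finite index sets yields a common upper bound, since finite joins grow
  with the index set. Only nonempty index sets count, so a member of \<open>I\<close> is needed to
  have any finite join at all.\<close>

lemma directed_finite_sups:
  assumes "I \<noteq> {}" "g \<in> I \<rightarrow> carrier L"
  shows "directed L {\<Squnion>(g ` S) | S. finite S \<and> S \<noteq> {} \<and> S \<subseteq> I}"
proof -
  have least: "is_lub L (\<Squnion>(g ` S)) (g ` S)" if "finite S" "S \<noteq> {}" "S \<subseteq> I" for S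
    using finite_sup_least[of "g ` S"] that assms by fast
  have mono: "\<Squnion>(g ` S) \<sqsubseteq> \<Squnion>(g ` T)" if "finite T" "S \<noteq> {}" "S \<subseteq> T" "T \<subseteq> I" for S T
  proof (rule least_le[OF least])
    show "finite S" "S \<noteq> {}" "S \<subseteq> I"
      using that finite_subset by auto
    have T: "T \<noteq> {}"
      using that by auto
    have "\<Squnion>(g ` T) \<in> Upper L (g ` T)"
      using that(1) T that(4) by (rule least_mem[OF least])
    then show "\<Squnion>(g ` T) \<in> Upper L (g ` S)"
      using Upper_antimono[OF image_mono[OF that(3)]] by (rule rev_subsetD)
  qed
  show ?thesis
    unfolding directed_def
  proof (intro conjI ballI)
    show "{\<Squnion>(g ` S) | S. finite S \<and> S \<noteq> {} \<and> S \<subseteq> I} \<subseteq> carrier L"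
      using least by auto
    show "{\<Squnion>(g ` S) | S. finite S \<and> S \<noteq> {} \<and> S \<subseteq> I} \<noteq> {}"
      using assms(1) by (auto intro!: exI[of _ "{SOME i. i \<in> I}"] simp: some_in_eq)
    fix x y
    assume "x \<in> {\<Squnion>(g ` S) | S. finite S \<and> S \<noteq> {} \<and> S \<subseteq> I}"
      and "y \<in> {\<Squnion>(g ` S) | S. finite S \<and> S \<noteq> {} \<and> S \<subseteq> I}"
    then obtain S T where "x = \<Squnion>(g ` S)" "finite S" "S \<noteq> {}" "S \<subseteq> I"
      and "y = \<Squnion>(g ` T)" "finite T" "T \<noteq> {}" "T \<subseteq> I"
      by blast
    then show "\<exists>z \<in> {\<Squnion>(g ` S) | S. finite S \<and> S \<noteq> {} \<and> S \<subseteq> I}. x \<sqsubseteq> z \<and> y \<sqsubseteq> z"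
      by (intro bexI[of _ "\<Squnion>(g ` (S \<union> T))"]) (auto intro!: mono)
  qed
qed

text \<open>A family and its set of finite joins have the same upper bounds: singletons recover the
  members, and a bound of the family bounds every finite join.\<close>

lemma dir_join_least:
  assumes "I \<noteq> {} \<or> (\<exists>b. least L b (carrier L))" and g: "g \<in> I \<rightarrow> carrier L"
  shows "is_lub L (dir_join L I g) (g ` I)"
proof (cases "I = {}")
  case True
  \<comment> \<open>There is no nonempty subset of the empty index set, so the supremum is over
    \<open>{}\<close>; its upper bounds are the whole carrier, and the assumed bottom is the least
    of them.\<close>
  then have "dir_join L I g = \<Squnion>{}"
    unfolding dir_join_def by (intro arg_cong[where f = "\<lambda>S. \<Squnion>S"]) auto
  then show ?thesis
    using True assms sup_eqI[of _ "{}"] by auto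
next
  case False
  let ?S = "{\<Squnion>(g ` S) | S. finite S \<and> S \<noteq> {} \<and> S \<subseteq> I}"
  have dir: "directed L ?S"
    using False g by (rule directed_finite_sups)
  have lub: "is_lub L (dir_join L I g) ?S"
    unfolding dir_join_def using dir by (rule directed_sup_least)
  have carr: "?S \<subseteq> carrier L"
    using dir unfolding directed_def by blast
  have fin: "is_lub L (\<Squnion>(g ` S)) (g ` S)" if "finite S" "S \<noteq> {}" "S \<subseteq> I" for S
    using finite_sup_least[of "g ` S"] that g by fast
  show ?thesis
  proof (rule least_UpperI)
    show "g ` I \<subseteq> carrier L" "dir_join L I g \<in> carrier L"
      using g lub by auto
  next
    fix x
    assume "x \<in> g ` I"
    then obtain i where i: "i \<in> I" "x = g i"
      by blast
    then have x: "x \<in> carrier L"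
      using g by auto
    have "\<Squnion>(g ` {i}) \<in> ?S"
      using i by blast
    moreover have "\<Squnion>(g ` {i}) = x"
      using x i sup_eqI sup_of_singletonI by simp
    ultimately show "x \<sqsubseteq> dir_join L I g"
      using least_Upper_above[OF lub _ carr] by simp
  next
    fix y
    assume y: "y \<in> Upper L (g ` I)"
    have "y \<in> Upper L ?S"
    proof (rule Upper_memI)
      show "y \<in> carrier L"
        using y unfolding Upper_def by blast
      fix z
      assume "z \<in> ?S"
      then obtain S where S: "z = \<Squnion>(g ` S)" "finite S" "S \<noteq> {}" "S \<subseteq> I"
        by blast
      moreover have "y \<in> Upper L (g ` S)"
        using y Upper_antimono[OF image_mono[OF S(4)]] by (rule rev_subsetD)
      ultimately show "z \<sqsubseteq> y"
        using least_le[OF fin] by simp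
    qed
    then show "dir_join L I g \<sqsubseteq> y"
      by (rule least_le[OF lub])
  qed
qed

section \<open>Kleene iteration from a start that need not be bottom\<close>

lemma directed_range_iterates:
  assumes closed: "F \<in> carrier L \<rightarrow> carrier L"
    and mono: "\<And>x y. \<lbrakk>x \<in> carrier L; y \<in> carrier L; x \<sqsubseteq> y\<rbrakk> \<Longrightarrow> F x \<sqsubseteq> F y"
    and b: "b \<in> carrier L" "b \<sqsubseteq> F b"
  shows "directed L (range (\<lambda>n. (F ^^ n) b))"
proof -
  have carr: "(F ^^ n) b \<in> carrier L" for n
    using closed b by (induction n) auto
  \<comment> \<open>The inequality \<open>b \<sqsubseteq> F b\<close> plays the part that minimality
    has for a bottom element; monotonicity carries it along the chain.\<close>
  have ascending: "(F ^^ n) b \<sqsubseteq> (F ^^ Suc n) b" for n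
  proof (induction n)
    case (Suc n)
    then show ?case
      using mono[OF carr carr, of n "Suc n"] by simp
  qed (use b in simp)
  have chain: "(F ^^ m) b \<sqsubseteq> (F ^^ n) b" if "m \<le> n" for m n
    using that
  proof (induction n rule: dec_induct)
    case base
    show ?case using carr by simp
  next
    case (step n)
    then show ?case
      using le_trans[OF step.IH ascending carr carr carr] by simp
  qed
  show ?thesis
    unfolding directed_def
  proof (intro conjI ballI)
    fix x y
    assume "x \<in> range (\<lambda>n. (F ^^ n) b)" "y \<in> range (\<lambda>n. (F ^^ n) b)"
    then obtain m n where "x = (F ^^ m) b" "y = (F ^^ n) b"
      by blast
    then show "\<exists>z \<in> range (\<lambda>n. (F ^^ n) b). x \<sqsubseteq> z \<and> y \<sqsubseteq> z"
      by (intro bexI[of _ "(F ^^ max m n) b"]) (use chain in auto)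
  qed (use carr in auto)
qed

text \<open>Kleene's argument without a bottom: continuity makes the supremum a fixed point, and
  since every fixed point lies above \<open>b\<close>, induction puts it above all iterates.\<close>

lemma mu_eq_sup_iterates:
  assumes closed: "F \<in> carrier L \<rightarrow> carrier L"
    and mono: "\<And>x y. \<lbrakk>x \<in> carrier L; y \<in> carrier L; x \<sqsubseteq> y\<rbrakk> \<Longrightarrow> F x \<sqsubseteq> F y"
    and cont: "\<And>S. directed L S \<Longrightarrow> F (\<Squnion>S) = \<Squnion>(F ` S)"
    and b: "b \<in> carrier L" "b \<sqsubseteq> F b"
    and above: "\<And>x. \<lbrakk>x \<in> carrier L; F x = x\<rbrakk> \<Longrightarrow> b \<sqsubseteq> x"
  shows "mu L F = \<Squnion>(range (\<lambda>n. (F ^^ n) b))"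
proof -
  let ?C = "range (\<lambda>n. (F ^^ n) b)"
  have dir: "directed L ?C"
    using closed mono b by (rule directed_range_iterates)
  have lub: "is_lub L (\<Squnion>?C) ?C"
    using dir by (rule directed_sup_least)
  have carr: "?C \<subseteq> carrier L"
    using dir unfolding directed_def by blast
  \<comment> \<open>\<open>F\<close> shifts the chain by one and so can lose only its first member
    \<open>b\<close>. A bound of the rest is above \<open>F b\<close>, hence above \<open>b\<close>.
    Thus \<open>F\<close> applied to the supremum returns the supremum.\<close>
  have "Upper L (F ` ?C) = Upper L ?C"
  proof -
    have C: "?C = insert b (F ` ?C)"
    proof -
      have "x \<in> insert b (F ` ?C)" if "x = (F ^^ n) b" for x n
        using that by (cases n) auto
      moreover have "F ((F ^^ n) b) \<in> ?C" for n
        by (rule range_eqI[of _ _ "Suc n"]) simp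
      moreover have "b \<in> ?C"
        by (rule range_eqI[of _ _ 0]) simp
      ultimately show ?thesis
        by blast
    qed
    have image: "F ` ?C \<subseteq> carrier L"
      using C carr by blast
    have "y \<in> Upper L (insert b (F ` ?C))" if y: "y \<in> Upper L (F ` ?C)" for y
    proof (rule Upper_memI)
      have above_image: "z \<sqsubseteq> y \<and> y \<in> carrier L" if "z \<in> F ` ?C" for z
        using y that image by (rule Upper_memD)
      have "F b \<in> F ` ?C"
        by (rule imageI, rule range_eqI[of _ _ 0]) simp
      then have Fb: "F b \<sqsubseteq> y" and y': "y \<in> carrier L"
        using above_image by auto
      show "y \<in> carrier L"
        by (rule y')
      have "b \<sqsubseteq> y"
        using b(2) Fb b(1) funcset_mem[OF closed b(1)] y' by (rule le_trans)
      then show "x \<sqsubseteq> y" if "x \<in> insert b (F ` ?C)" for x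
        using that above_image by (elim insertE) simp_all
    qed
    then have "Upper L (F ` ?C) \<subseteq> Upper L (insert b (F ` ?C))"
      by (rule subsetI)
    then have "Upper L (insert b (F ` ?C)) = Upper L (F ` ?C)"
      by (rule equalityI[OF Upper_antimono[OF subset_insertI]])
    then show ?thesis
      using C by simp
  qed
  then have "\<Squnion>(F ` ?C) = \<Squnion>?C"
    using lub by (intro sup_eqI) simp
  then have "F (\<Squnion>?C) = \<Squnion>?C"
    using cont[OF dir] by simp
  moreover have "\<Squnion>?C \<sqsubseteq> x" if x: "x \<in> carrier L" "F x = x" for x
  proof (rule least_le[OF lub], rule Upper_memI)
    have "(F ^^ n) b \<sqsubseteq> x" for n
    proof (induction n)
      case 0
      show ?case using above x by simp
    next
      case (Suc n)
      moreover have "(F ^^ n) b \<in> carrier L"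
        using carr by blast
      ultimately have "F ((F ^^ n) b) \<sqsubseteq> F x"
        using mono x(1) by simp
      then show ?case
        using x(2) by simp
    qed
    then show "y \<sqsubseteq> x" if "y \<in> ?C" for y
      using that by blast
  qed (rule x(1))
  ultimately have least: "least L (\<Squnion>?C) (fps L F)"
    using least_closed[OF lub] by (auto simp: least_def fps_def eq_is_equal)
  \<comment> \<open>\<open>mu\<close> is a definite description, so uniqueness of the least element
    is required as well.\<close>
  show ?thesis
    unfolding mu_def using least by (rule the_equality) (rule least_unique[OF _ least])
qed

end

section \<open>Joins of compositions\<close>

lemma hom_poset_simps [simp]:
  "carrier (hom_poset K A B) = Hom K A B"
  "x \<sqsubseteq>\<^bsub>hom_poset K A B\<^esub> y \<longleftrightarrow> Le K x y"
  by (simp_all add: hom_poset_def)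

context dcpo_join_category
begin

lemma Hom_ObjD:
  assumes "f \<in> Hom K A B"
  shows "A \<in> Obj K" "B \<in> Obj K"
  using assms Dom_in_Obj Cod_in_Obj unfolding Hom_def by auto

lemma Hom_dcpo: "f \<in> Hom K A B \<Longrightarrow> dcpo_with_joins (hom_poset K A B)"
  using hom_dcpo Hom_ObjD by blast

lemma Comp_mono_left:
  assumes "f \<in> Hom K A B" "g \<in> Hom K B E" "g' \<in> Hom K B E" "Le K g g'"
  shows "Le K (g \<odot> f) (g' \<odot> f)"
proof -
  interpret dcpo_with_joins "hom_poset K A B"
    using assms(1) by (rule Hom_dcpo)
  have "Le K f f"
    using le_refl assms(1) by simp
  then show ?thesis
    using Comp_mono assms by blast
qed

text \<open>Left distributivity handles each insertion. The induction starts at singletons because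
  composition is not assumed to preserve an empty join.\<close>

lemma Comp_finite_sup:
  assumes "left_distributive K" "finite S" "S \<noteq> {}" "S \<subseteq> Hom K A B" "h \<in> Hom K B E"
  shows "h \<odot> (\<Squnion>\<^bsub>hom_poset K A B\<^esub> S) = \<Squnion>\<^bsub>hom_poset K A E\<^esub> ((\<lambda>g. h \<odot> g) ` S)"
proof -
  have obj: "A \<in> Obj K" "B \<in> Obj K" "E \<in> Obj K"
    using assms Hom_ObjD by blast+
  interpret AB: dcpo_with_joins "hom_poset K A B"
    using obj by (intro hom_dcpo)
  interpret AE: dcpo_with_joins "hom_poset K A E"
    using obj by (intro hom_dcpo)
  have comp: "h \<odot> g \<in> Hom K A E" if "g \<in> Hom K A B" for g
    using that assms(5) by (rule Comp_in_Hom)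
  show ?thesis
    using assms(2,3,4)
  proof (induction S rule: finite_ne_induct)
    case (singleton g)
    then have "\<Squnion>\<^bsub>hom_poset K A B\<^esub> {g} = g" "\<Squnion>\<^bsub>hom_poset K A E\<^esub> {h \<odot> g} = h \<odot> g"
      using comp by (auto intro!: AB.sup_eqI AE.sup_eqI AB.sup_of_singletonI AE.sup_of_singletonI)
    then show ?case by simp
  next
    case (insert g S)
    have S: "\<Squnion>\<^bsub>hom_poset K A B\<^esub> S \<in> Hom K A B"
      using AB.finite_sup_closed[of S] insert by simp
    have image: "(\<lambda>g. h \<odot> g) ` S \<subseteq> Hom K A E" "h \<odot> g \<in> Hom K A E"
      using insert.prems comp by auto
    have "h \<odot> (\<Squnion>\<^bsub>hom_poset K A B\<^esub> (insert g S))
        = h \<odot> (g \<squnion>\<^bsub>hom_poset K A B\<^esub> \<Squnion>\<^bsub>hom_poset K A B\<^esub> S)"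
      using AB.sup_insert[of S g] insert by simp
    also have "\<dots> = (h \<odot> g) \<squnion>\<^bsub>hom_poset K A E\<^esub> (h \<odot> (\<Squnion>\<^bsub>hom_poset K A B\<^esub> S))"
      using assms(1,5) S insert.prems obj unfolding left_distributive_def by simp
    also have "\<dots> = \<Squnion>\<^bsub>hom_poset K A E\<^esub> (insert (h \<odot> g) ((\<lambda>g. h \<odot> g) ` S))"
      using AE.sup_insert[of "(\<lambda>g. h \<odot> g) ` S" "h \<odot> g"] image insert by simp
    finally show ?case by simp
  qed
qed

text \<open>Postcomposition maps the set of finite joins onto the set of finite joins of the
  composites; as this set is directed, its supremum is preserved too.\<close>

lemma Comp_dir_join:
  assumes "left_distributive K" "I \<noteq> {}" and g: "g \<in> I \<rightarrow> Hom K A B" and h: "h \<in> Hom K B E"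
  shows "h \<odot> dir_join (hom_poset K A B) I g = dir_join (hom_poset K A E) I (\<lambda>i. h \<odot> g i)"
proof -
  \<comment> \<open>A member of \<open>I\<close> shows that \<open>A\<close> is an object, being the
    domain of some \<open>g i\<close>.\<close>
  obtain i where "i \<in> I"
    using assms(2) by blast
  then have A: "A \<in> Obj K"
    using g Hom_ObjD(1) by blast
  interpret dcpo_with_joins "hom_poset K A B"
    using A h Hom_ObjD(1) by (intro hom_dcpo)
  have fin: "h \<odot> \<Squnion>\<^bsub>hom_poset K A B\<^esub> (g ` S) = \<Squnion>\<^bsub>hom_poset K A E\<^esub> ((\<lambda>i. h \<odot> g i) ` S)"
    if "finite S" "S \<noteq> {}" "S \<subseteq> I" for S
  proof -
    have "g ` S \<subseteq> Hom K A B"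
      using that(3) g by auto
    then show ?thesis
      using Comp_finite_sup[OF assms(1) _ _ _ h, of "g ` S"] that(1,2) by (simp add: image_image)
  qed
  have "(\<lambda>g. h \<odot> g) ` {\<Squnion>\<^bsub>hom_poset K A B\<^esub> (g ` S) | S. finite S \<and> S \<noteq> {} \<and> S \<subseteq> I}
      = {\<Squnion>\<^bsub>hom_poset K A E\<^esub> ((\<lambda>i. h \<odot> g i) ` S) | S. finite S \<and> S \<noteq> {} \<and> S \<subseteq> I}"
    unfolding setcompr_eq_image image_image by (rule image_cong) (simp_all add: fin)
  moreover have "directed (hom_poset K A B)
      {\<Squnion>\<^bsub>hom_poset K A B\<^esub> (g ` S) | S. finite S \<and> S \<noteq> {} \<and> S \<subseteq> I}"
    using assms(2) g by (intro directed_finite_sups) simp_all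
  ultimately show ?thesis
    unfolding dir_join_def using Comp_sup_right[OF A h] by simp
qed

end

section \<open>Saturation along a family of endomorphisms\<close>

text \<open>The last assumption covers the degenerate case of an empty indexing category, where
  \<open>dir_join\<close> is the supremum of the empty set and \<open>X\<close> is initial.\<close>

locale saturation = dcpo_join_category K for K (structure) +
  fixes I :: "'i set" and a :: "'i \<Rightarrow> 'm" and X :: 'o
  assumes left_distrib: "left_distributive K"
    and X_Obj: "X \<in> Obj K"
    and endo: "a \<in> I \<rightarrow> Hom K X X"
    and nonempty_or_initial: "I \<noteq> {} \<or> (\<forall>Z \<in> Obj K. \<exists>h. Hom K X Z = {h})"
begin

definition joins :: "'o \<Rightarrow> 'm \<Rightarrow> 'm" where
  "joins Z x = dir_join (hom_poset K X Z) I (\<lambda>i. x \<odot> a i)"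

text \<open>This is \<open>sat_map\<close> with arbitrary endomorphisms \<open>a i\<close> in place
  of the lifted arrows.\<close>

definition sat :: "'o \<Rightarrow> 'm \<Rightarrow> 'm \<Rightarrow> 'm" where
  "sat Z f x = f \<squnion>\<^bsub>hom_poset K X Z\<^esub> joins Z x"

lemma Comp_endo: "\<lbrakk>x \<in> Hom K X Z; i \<in> I\<rbrakk> \<Longrightarrow> x \<odot> a i \<in> Hom K X Z"
  using endo Comp_in_Hom by blast

text \<open>Allows order arguments about \<open>joins\<close> without unfolding finite joins. For
  empty \<open>I\<close> the sole element of the hom-poset serves as its bottom.\<close>

lemma joins_least:
  assumes "x \<in> Hom K X Z"
  shows "is_lub (hom_poset K X Z) (joins Z x) ((\<lambda>i. x \<odot> a i) ` I)"
proof -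
  interpret dcpo_with_joins "hom_poset K X Z"
    using assms by (rule Hom_dcpo)
  have "I \<noteq> {} \<or> (\<exists>b. least (hom_poset K X Z) b (carrier (hom_poset K X Z)))"
    using nonempty_or_initial
  proof
    assume "\<forall>Z \<in> Obj K. \<exists>h. Hom K X Z = {h}"
    then obtain h where "Hom K X Z = {h}"
      using Hom_ObjD(2)[OF assms] by blast
    then have "least (hom_poset K X Z) h (carrier (hom_poset K X Z))"
      using le_refl[of h] by (simp add: least_def)
    then show ?thesis by blast
  qed simp
  then show ?thesis
    unfolding joins_def using assms Comp_endo by (intro dir_join_least) auto
qed

lemma joins_in_Hom: "x \<in> Hom K X Z \<Longrightarrow> joins Z x \<in> Hom K X Z"
  using least_closed[OF joins_least] by simp

lemma joins_above: "\<lbrakk>x \<in> Hom K X Z; i \<in> I\<rbrakk> \<Longrightarrow> Le K (x \<odot> a i) (joins Z x)"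
  using least_Upper_above[OF joins_least] Comp_endo by (simp add: image_subset_iff)

lemma joins_le:
  assumes "x \<in> Hom K X Z" "u \<in> Hom K X Z" "\<And>i. i \<in> I \<Longrightarrow> Le K (x \<odot> a i) u"
  shows "Le K (joins Z x) u"
  using least_le[OF joins_least[OF assms(1)], of u] Upper_memI[of "(\<lambda>i. x \<odot> a i) ` I" "hom_poset K X Z" u] assms
  by auto

lemma Comp_joins:
  assumes "x \<in> Hom K X Z" "h \<in> Hom K Z E"
  shows "h \<odot> joins Z x = joins E (h \<odot> x)"
proof (cases "I = {}")
  case True
  then obtain k where "Hom K X E = {k}"
    using nonempty_or_initial assms Hom_ObjD(2) by blast
  moreover have "h \<odot> joins Z x \<in> Hom K X E" "joins E (h \<odot> x) \<in> Hom K X E"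
    using assms joins_in_Hom Comp_in_Hom by blast+
  ultimately show ?thesis by simp
next
  case False
  \<comment> \<open>Associativity is available only for \<open>i \<in> I\<close>, so the two
    families need not agree as functions; their sets of finite joins, written \<open>?J\<close>, are
    compared instead.\<close>
  let ?J = "\<lambda>g. {\<Squnion>\<^bsub>hom_poset K X E\<^esub> (g ` S) | S. finite S \<and> S \<noteq> {} \<and> S \<subseteq> I}"
  have "h \<odot> joins Z x = dir_join (hom_poset K X E) I (\<lambda>i. h \<odot> (x \<odot> a i))"
    unfolding joins_def using False left_distrib assms Comp_endo by (intro Comp_dir_join) auto
  also have "\<dots> = joins E (h \<odot> x)"
  proof -
    have "h \<odot> (x \<odot> a i) = (h \<odot> x) \<odot> a i" if "i \<in> I" for i
      using that endo assms Comp_assoc by blast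
    then have "(\<lambda>i. h \<odot> (x \<odot> a i)) ` S = (\<lambda>i. (h \<odot> x) \<odot> a i) ` S" if "S \<subseteq> I" for S
      using that by (intro image_cong) auto
    then have "?J (\<lambda>i. h \<odot> (x \<odot> a i)) = ?J (\<lambda>i. (h \<odot> x) \<odot> a i)"
      unfolding setcompr_eq_image by (intro image_cong) simp_all
    then show ?thesis
      unfolding joins_def dir_join_def by simp
  qed
  finally show ?thesis .
qed

section \<open>Monotonicity and continuity of the saturation map\<close>

lemma sat_in_Hom:
  assumes "f \<in> Hom K X Z" "x \<in> Hom K X Z"
  shows "sat Z f x \<in> Hom K X Z"
proof -
  interpret dcpo_with_joins "hom_poset K X Z"
    using assms(1) by (rule Hom_dcpo)
  show ?thesis
    unfolding sat_def using join_closed assms joins_in_Hom by simp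
qed

lemma sat_above:
  assumes "f \<in> Hom K X Z" "x \<in> Hom K X Z"
  shows "Le K f (sat Z f x)" "i \<in> I \<Longrightarrow> Le K (x \<odot> a i) (sat Z f x)"
proof -
  interpret dcpo_with_joins "hom_poset K X Z"
    using assms(1) by (rule Hom_dcpo)
  show "Le K f (sat Z f x)"
    unfolding sat_def using join_left[of f "joins Z x"] assms joins_in_Hom by simp
  have right: "Le K (joins Z x) (sat Z f x)"
    unfolding sat_def using join_right[of f "joins Z x"] assms joins_in_Hom by simp
  show "Le K (x \<odot> a i) (sat Z f x)" if "i \<in> I"
    using le_trans[of "x \<odot> a i" "joins Z x" "sat Z f x"] right joins_above assms that
      Comp_endo joins_in_Hom sat_in_Hom by simp
qed

lemma sat_le:
  assumes "f \<in> Hom K X Z" "x \<in> Hom K X Z" "u \<in> Hom K X Z"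
    and "Le K f u" "\<And>i. i \<in> I \<Longrightarrow> Le K (x \<odot> a i) u"
  shows "Le K (sat Z f x) u"
proof -
  interpret dcpo_with_joins "hom_poset K X Z"
    using assms(1) by (rule Hom_dcpo)
  show ?thesis
    unfolding sat_def using join_le[of f u "joins Z x"] assms joins_in_Hom joins_le by simp
qed

lemma sat_mono:
  assumes "f \<in> Hom K X Z" "x \<in> Hom K X Z" "y \<in> Hom K X Z" "Le K x y"
  shows "Le K (sat Z f x) (sat Z f y)"
proof (rule sat_le[OF assms(1,2)])
  interpret dcpo_with_joins "hom_poset K X Z"
    using assms(1) by (rule Hom_dcpo)
  show "sat Z f y \<in> Hom K X Z" "Le K f (sat Z f y)"
    using assms sat_in_Hom sat_above by auto
  fix i
  assume i: "i \<in> I"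
  then have "Le K (x \<odot> a i) (y \<odot> a i)"
    using Comp_mono_left endo assms by blast
  then show "Le K (x \<odot> a i) (sat Z f y)"
    using le_trans[of "x \<odot> a i" "y \<odot> a i" "sat Z f y"] i assms sat_above(2)[OF assms(1,3) i]
      Comp_endo sat_in_Hom by simp
qed

text \<open>Precomposition with each \<open>a i\<close> preserves directed suprema, and joins
  commute with suprema. Instead of interchanging suprema, the proof checks directly that the left
  side is the least upper bound: monotonicity makes it a bound, \<open>sat_le\<close> makes it
  least.\<close>

lemma sat_directed_sup:
  assumes f: "f \<in> Hom K X Z" and dir: "directed (hom_poset K X Z) S"
  shows "sat Z f (\<Squnion>\<^bsub>hom_poset K X Z\<^esub> S) = \<Squnion>\<^bsub>hom_poset K X Z\<^esub> (sat Z f ` S)"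
proof -
  interpret dcpo_with_joins "hom_poset K X Z"
    using f by (rule Hom_dcpo)
  let ?s = "\<Squnion>\<^bsub>hom_poset K X Z\<^esub> S"
  have S: "S \<subseteq> Hom K X Z" "S \<noteq> {}"
    using dir unfolding directed_def by auto
  have lub: "is_lub (hom_poset K X Z) ?s S"
    using dir by (rule directed_sup_least)
  have s: "?s \<in> Hom K X Z"
    using least_closed[OF lub] by simp
  have "is_lub (hom_poset K X Z) (sat Z f ?s) (sat Z f ` S)"
  proof (rule least_UpperI)
    show "sat Z f ` S \<subseteq> carrier (hom_poset K X Z)" "sat Z f ?s \<in> carrier (hom_poset K X Z)"
      using S(1) s f sat_in_Hom by auto
    have "Le K (sat Z f y) (sat Z f ?s)" if "y \<in> S" for y
      using sat_mono[OF f _ s] least_Upper_above[OF lub that] that S(1) by auto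
    then show "x \<sqsubseteq>\<^bsub>hom_poset K X Z\<^esub> sat Z f ?s" if "x \<in> sat Z f ` S" for x
      using that by auto
  next
    fix u
    assume "u \<in> Upper (hom_poset K X Z) (sat Z f ` S)"
    then have u: "u \<in> Hom K X Z" and above: "Le K (sat Z f y) u" if "y \<in> S" for y
      using that S(1) f sat_in_Hom unfolding Upper_def by auto
    \<comment> \<open>A directed set is nonempty. Its member \<open>y\<close> gives
      \<open>f \<le> sat Z f y \<le> u\<close>, and discharges the condition under which
      \<open>u\<close> was recorded as an arrow.\<close>
    obtain y where y: "y \<in> S"
      using S(2) by blast
    have "Le K (sat Z f ?s) u"
    proof (rule sat_le[OF f s u[OF y]])
      show "Le K f u"
        using le_trans[of f "sat Z f y" u] above[OF y] sat_above(1)[OF f, of y] y S(1) f u[OF y] sat_in_Hom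
        by auto
      fix i
      assume i: "i \<in> I"
      have ai: "a i \<in> Hom K X X"
        using endo i by auto
      \<comment> \<open>Precomposing \<open>S\<close> with \<open>a i\<close> gives a directed set
        whose supremum is \<open>?s \<odot> a i\<close>, so it suffices to bound each member
        \<open>p \<odot> a i\<close>, which lies below \<open>sat Z f p\<close>.\<close>
      let ?T = "(\<lambda>x. x \<odot> a i) ` S"
      have T: "?T \<subseteq> Hom K X Z"
        using Comp_endo i S(1) by auto
      have "directed (hom_poset K X Z) ?T"
        unfolding directed_def
      proof (intro conjI ballI)
        show "?T \<subseteq> carrier (hom_poset K X Z)" "?T \<noteq> {}"
          using T S(2) by auto
        fix v w
        assume "v \<in> ?T" "w \<in> ?T"
        then obtain p q where pq: "p \<in> S" "q \<in> S" "v = p \<odot> a i" "w = q \<odot> a i"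
          by blast
        moreover obtain r where r: "r \<in> S" "Le K p r" "Le K q r"
          using dir pq(1,2) unfolding directed_def hom_poset_simps by blast
        ultimately have "Le K v (r \<odot> a i)" "Le K w (r \<odot> a i)"
          using pq S(1) Comp_mono_left[OF ai] by blast+
        then show "\<exists>z \<in> ?T. v \<sqsubseteq>\<^bsub>hom_poset K X Z\<^esub> z \<and> w \<sqsubseteq>\<^bsub>hom_poset K X Z\<^esub> z"
          using r(1) by auto
      qed
      then have "is_lub (hom_poset K X Z) (?s \<odot> a i) ?T"
        using Comp_sup_left[OF ai Hom_ObjD(2)[OF f] dir] directed_sup_least by simp
      moreover have "u \<in> Upper (hom_poset K X Z) ?T"
      proof (rule Upper_memI)
        fix v
        assume "v \<in> ?T"
        then obtain p where p: "p \<in> S" "v = p \<odot> a i"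
          by blast
        then have p': "p \<in> Hom K X Z"
          using S(1) by blast
        show "v \<sqsubseteq>\<^bsub>hom_poset K X Z\<^esub> u"
          using le_trans[of v "sat Z f p" u] p sat_above(2)[OF f p' i] above[OF p(1)]
            Comp_endo[OF p' i] sat_in_Hom[OF f p'] u[OF y] by simp
      qed (use u[OF y] in simp)
      ultimately show "Le K (?s \<odot> a i) u"
        using least_le[of "hom_poset K X Z"] by fastforce
    qed
    then show "sat Z f ?s \<sqsubseteq>\<^bsub>hom_poset K X Z\<^esub> u"
      by simp
  qed
  then show ?thesis
    by (simp add: sup_eqI)
qed

section \<open>Least fixed points of saturation maps and their composites\<close>

lemma directed_sat_iterates:
  assumes "f \<in> Hom K X Z"
  shows "directed (hom_poset K X Z) (range (\<lambda>n. (sat Z f ^^ n) f))"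
proof -
  interpret dcpo_with_joins "hom_poset K X Z"
    using assms by (rule Hom_dcpo)
  show ?thesis
    using assms by (intro directed_range_iterates) (auto intro: sat_in_Hom sat_mono sat_above)
qed

text \<open>The constant term \<open>f\<close> is a valid start for the iteration: it is below every
  value of \<open>sat Z f\<close>, hence below \<open>sat Z f f\<close> and below every fixed
  point.\<close>

lemma mu_sat:
  assumes "f \<in> Hom K X Z"
  shows "mu (hom_poset K X Z) (sat Z f) = \<Squnion>\<^bsub>hom_poset K X Z\<^esub> (range (\<lambda>n. (sat Z f ^^ n) f))"
proof -
  interpret dcpo_with_joins "hom_poset K X Z"
    using assms by (rule Hom_dcpo)
  have "Le K f x" if "x \<in> Hom K X Z" "sat Z f x = x" for x
    using sat_above(1)[OF assms that(1)] that(2) by simp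
  then show ?thesis
    using assms by (intro mu_eq_sup_iterates) (auto intro: sat_in_Hom sat_mono sat_above sat_directed_sup)
qed

text \<open>Left distributivity moves \<open>h\<close> past the outer join,
  \<open>Comp_joins\<close> past the inner one.\<close>

lemma Comp_sat:
  assumes "f \<in> Hom K X Z" "x \<in> Hom K X Z" "h \<in> Hom K Z E"
  shows "h \<odot> sat Z f x = sat E (h \<odot> f) (h \<odot> x)"
  using left_distrib assms joins_in_Hom[OF assms(2)] Comp_joins[OF assms(2,3)] Hom_ObjD[OF assms(1)]
    Hom_ObjD(2)[OF assms(3)]
  unfolding sat_def left_distributive_def by simp

text \<open>The constant term is kept general here; the theorem is the case where it is the identity
  of \<open>X\<close> and \<open>h\<close> is the given arrow.\<close>

lemma Comp_mu_sat:
  assumes f: "f \<in> Hom K X Z" and h: "h \<in> Hom K Z E"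
  shows "h \<odot> mu (hom_poset K X Z) (sat Z f) = mu (hom_poset K X E) (sat E (h \<odot> f))"
proof -
  have iter: "(sat Z f ^^ n) f \<in> Hom K X Z" for n
    using f by (induction n) (auto intro: sat_in_Hom)
  have "h \<odot> (sat Z f ^^ n) f = (sat E (h \<odot> f) ^^ n) (h \<odot> f)" for n
    by (induction n) (simp_all add: Comp_sat[OF f iter h])
  then show ?thesis
    using mu_sat[OF f] mu_sat[OF Comp_in_Hom[OF f h]]
      Comp_sup_right[OF X_Obj h directed_sat_iterates[OF f]]
    by (simp add: image_image)
qed

end

section \<open>Cotuples, lifted arrows and the empty coproduct\<close>

lemma cotuple_in_Hom:
  assumes "is_coproduct K I P X \<iota>" "Z \<in> Obj K" "\<And>i. i \<in> I \<Longrightarrow> g i \<in> Hom K (P i) Z"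
  shows "cotuple K I X \<iota> Z g \<in> Hom K X Z"
proof -
  have "\<exists>!h. h \<in> Hom K X Z \<and> (\<forall>i \<in> I. h \<odot>\<^bsub>K\<^esub> \<iota> i = g i)"
    using assms unfolding is_coproduct_def by blast
  then show ?thesis
    unfolding cotuple_def by (rule theI'[THEN conjunct1])
qed

text \<open>Supplies the assumption \<open>endo\<close> of \<open>saturation\<close>: every
  component of the defining cotuple ends in \<open>X\<close>.\<close>

lemma lift_arr_in_Hom:
  assumes "category D" "category K" "lax_functor D K \<pi>"
    and coprod: "is_coproduct K (Obj D) (fobj \<pi>) X \<iota>" and d: "d \<in> Arr D"
  shows "lift_arr D K \<pi> X \<iota> d \<in> Hom K X X"
  unfolding lift_arr_def
proof (rule cotuple_in_Hom[OF coprod])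
  show "X \<in> Obj K"
    using coprod unfolding is_coproduct_def by blast
  have in_Hom: "\<iota> A \<in> Hom K (fobj \<pi> A) X" if "A \<in> Obj D" for A
    using coprod that unfolding is_coproduct_def by blast
  have "farr \<pi> d \<in> Hom K (fobj \<pi> (Dom D d)) (fobj \<pi> (Cod D d))"
    using assms(3) d unfolding lax_functor_def by blast
  then have "\<iota> (Cod D d) \<odot>\<^bsub>K\<^esub> farr \<pi> d \<in> Hom K (fobj \<pi> (Dom D d)) X"
    using category.Comp_in_Hom[OF assms(2)] in_Hom[OF category.Cod_in_Obj[OF assms(1) d]] by blast
  then show "(if A = Dom D d then \<iota> (Cod D d) \<odot>\<^bsub>K\<^esub> farr \<pi> d else \<iota> A) \<in> Hom K (fobj \<pi> A) X"
    if "A \<in> Obj D" for A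
    using that in_Hom by simp
qed

text \<open>Over an empty index set the conditions on a mediating arrow are vacuous, so its unique
  existence is initiality.\<close>

lemma is_coproduct_empty_initial:
  assumes "is_coproduct K {} P X \<iota>" "Z \<in> Obj K"
  shows "\<exists>h. Hom K X Z = {h}"
proof -
  have "\<exists>!h. h \<in> Hom K X Z"
    using assms unfolding is_coproduct_def by simp
  then show ?thesis
    by blast
qed

theorem theorem4p6:
  fixes D :: "('d, 'a) category"
    and K :: "('o, 'm) ord_category"
    and J :: "('o, 'm) category"
    and \<pi> :: "('d, 'a, 'o, 'm) functor_data"
    and X Y :: 'o
    and \<iota> :: "'d \<Rightarrow> 'm"
    and f :: 'm
  assumes "category D"
    and "dcpo_join_category K"
    and "left_distributive K"
    and "subcategory J K" and "Obj J = Obj K"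
    and "admits_coproducts K (Obj D)"
    and "cotupling_monotone K (Obj D)"
    and "lax_functor D K \<pi>"
    and "is_coproduct K (Obj D) (fobj \<pi>) X \<iota>"
    and "f \<in> Hom J X Y"
  shows "mu (hom_poset K X Y) (sat_map D K \<pi> X \<iota> Y f)
      = f \<odot>\<^bsub>K\<^esub> mu (hom_poset K X X) (sat_map D K \<pi> X \<iota> X (Id K X)) \<and>
    (\<forall>\<beta> \<in> Hom K Y Y.
      mu (hom_poset K X Y) (sat_map D K \<pi> X \<iota> Y f) = \<beta> \<odot>\<^bsub>K\<^esub> f \<longleftrightarrow>
      f \<odot>\<^bsub>K\<^esub> mu (hom_poset K X X) (sat_map D K \<pi> X \<iota> X (Id K X)) = \<beta> \<odot>\<^bsub>K\<^esub> f)"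
proof -
  interpret K: dcpo_join_category K
    by fact
  have X: "X \<in> Obj K"
    using \<open>is_coproduct K (Obj D) (fobj \<pi>) X \<iota>\<close> unfolding is_coproduct_def by blast
  have f: "f \<in> Hom K X Y"
    using \<open>subcategory J K\<close> \<open>f \<in> Hom J X Y\<close> unfolding subcategory_def Hom_def by auto
  \<comment> \<open>Without arrows there are no identities, hence no objects, and \<open>X\<close>
    is an empty coproduct.\<close>
  have initial: "\<forall>Z \<in> Obj K. \<exists>h. Hom K X Z = {h}" if "Arr D = {}"
  proof -
    have "Obj D = {}"
      using that category.Id_in_Hom[OF \<open>category D\<close>] unfolding Hom_def by blast
    then show ?thesis
      using is_coproduct_empty_initial \<open>is_coproduct K (Obj D) (fobj \<pi>) X \<iota>\<close> by metis
  qed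
  interpret saturation K "Arr D" "lift_arr D K \<pi> X \<iota>" X
  proof
    show "lift_arr D K \<pi> X \<iota> \<in> Arr D \<rightarrow> Hom K X X"
      using lift_arr_in_Hom[OF _ K.category_axioms] assms(1,8,9) by (intro funcsetI)
  qed (use assms X initial in auto)
  have sat_map: "sat_map D K \<pi> X \<iota> Z g = sat Z g" for Z g
    by (simp add: fun_eq_iff sat_map_def sat_def joins_def)
  have "mu (hom_poset K X Y) (sat_map D K \<pi> X \<iota> Y f)
      = f \<odot>\<^bsub>K\<^esub> mu (hom_poset K X X) (sat_map D K \<pi> X \<iota> X (Id K X))"
    \<comment> \<open>Composition turns the constant term \<open>Id K X\<close> into
      \<open>f \<odot> Id K X\<close>, which is \<open>f\<close>.\<close>
    using Comp_mu_sat[OF K.Id_in_Hom[OF X] f] K.Id_right[OF f] by (simp add: sat_map)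
  then show ?thesis
    by simp
qed

end
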